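(* Let $f:\mathbb{N}\to\mathbb{C}$ be a multiplicative function. For $s\in\mathbb{C}$ and each prime $p$ put $a_p:=\sum_{m=1}^{\infty}\frac{f(p^m)}{p^{ms}}$. Let $\sigma_a\in\mathbb{R}$ and suppose that for every $s\in\mathbb{C}$ with $\sigma=\Re(s)>\sigma_a$ one has $a_p\neq -1$ for every prime $p$, and that the series $\sum_{n\in\mathbb{N}}\frac{f(n)}{n^s}$ and $\sum_{p}\frac{a_p}{1+a_p}$ both converge absolutely for $\sigma>\sigma_a$. Then, for every $s$ with $\sigma>\sigma_a$, $$\sum_{n\in\mathbb{N}}\frac{\omega(n)f(n)}{n^s} = \left(\sum_{n\in\mathbb{N}}\frac{f(n)}{n^s}\right)\left(\sum_{p}\frac{a_p}{1+a_p}\right),$$ and the series on the left-hand side converges absolutely for $\sigma>\sigma_a$.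
   Context: $\mathbb{N}=\{1,2,3,\ldots\}$. $\omega(n)$ is the number of distinct prime factors of $n$, with $\omega(1)=0$. A multiplicative function satisfies $f(1)=1$ and $f(nm)=f(n)f(m)$ whenever $\gcd(n,m)=1$. $\sum_p$ denotes a sum over all primes $p$. For $s\in\mathbb{C}$, write $s=\sigma+it$ with $\sigma,t\in\mathbb{R}$. *)

theory Defs
  imports
    "HOL-Analysis.Analysis"
    "HOL-Computational_Algebra.Primes"
begin

text \<open>
  The mathematical domain of an arithmetic function is \<open>{1, 2, 3, \<dots>}\<close>; the value at \<open>0 :: nat\<close>
  plays no role anywhere below.
\<close>

definition multiplicative_fun :: "(nat \<Rightarrow> complex) \<Rightarrow> bool" where
  "multiplicative_fun f \<longleftrightarrow>
     f 1 = 1 \<and> (\<forall>m n. m \<ge> 1 \<longrightarrow> n \<ge> 1 \<longrightarrow> coprime m n \<longrightarrow> f (m * n) = f m * f n)"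

definition omega :: "nat \<Rightarrow> nat" where
  "omega n = card (prime_factors n)"

text \<open>
  The local sum \<open>a\<^sub>p = (\<Sum>m\<ge>1. f (p^m) / p^(m s))\<close> as an ordinary series, with the index shifted
  so that \<open>Suc m\<close> runs through \<open>1, 2, \<dots>\<close>.
\<close>

definition local_sum :: "(nat \<Rightarrow> complex) \<Rightarrow> complex \<Rightarrow> nat \<Rightarrow> complex" where
  "local_sum f s p = (\<Sum>m. f (p ^ Suc m) / of_nat p powr (of_nat (Suc m) * s))"

end

theory Submission
  imports Defs
begin

text \<open>
  Write \<open>g n = f n / n\<^sup>s\<close>, \<open>G = \<Sum>g\<close> and, for a prime \<open>p\<close>, \<open>B\<^sub>p = \<Sum>\<^bsub>p \<nmid> k\<^esub> g k\<close>. Splitting off the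
  \<open>p\<close>-part of \<open>n\<close> gives \<open>\<Sum>\<^bsub>p | n\<^esub> g n = a\<^sub>p B\<^sub>p\<close>, hence \<open>G = (1 + a\<^sub>p) B\<^sub>p\<close>, and so the part of \<open>G\<close>
  over the multiples of \<open>p\<close> is \<open>G a\<^sub>p / (1 + a\<^sub>p)\<close>. Summing over \<open>p\<close> counts each \<open>g n\<close> exactly
  \<open>\<omega>(n)\<close> times. The interchange of summations is licensed by \<open>\<omega>(n) \<le> log\<^sub>2 n = O(n\<^sup>\<epsilon>)\<close>, which is
  absorbed by moving \<open>s\<close> slightly to the left.
\<close>

lemma multiplicative_funD:
  assumes "multiplicative_fun g" "m \<ge> 1" "n \<ge> 1" "coprime m n"
  shows "g (m * n) = g m * g n"
  using assms unfolding multiplicative_fun_def by blast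

text \<open>Each multiple n of p factors uniquely as p^e k with e = \<open>multiplicity p n\<close>
  \<ge> 1 and k prime to p. Writing e as \<open>Suc m\<close> matches the indexing of
  \<open>local_sum\<close>.\<close>

lemma bij_betw_prime_part:
  fixes p :: nat
  assumes p: "prime p"
  shows "bij_betw (\<lambda>(m, k). p ^ Suc m * k) (UNIV \<times> {k\<in>{1..}. \<not> p dvd k}) {n\<in>{1..}. p dvd n}"
proof (rule bij_betwI[where g = "\<lambda>n. (multiplicity p n - 1, n div p ^ multiplicity p n)"])
  have p0: "p > 0" using p by (simp add: prime_gt_0_nat)
  show "(\<lambda>(m, k). p ^ Suc m * k) \<in> UNIV \<times> {k\<in>{1..}. \<not> p dvd k} \<rightarrow> {n\<in>{1..}. p dvd n}"
    using p0 by (auto simp: Suc_le_eq)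
  show "(\<lambda>n. (multiplicity p n - 1, n div p ^ multiplicity p n))
          \<in> {n\<in>{1..}. p dvd n} \<rightarrow> UNIV \<times> {k\<in>{1..}. \<not> p dvd k}"
  proof (safe, goal_cases)
    case (2 n)
    have "p ^ multiplicity p n \<le> n"
      using 2 by (intro dvd_imp_le multiplicity_dvd) auto
    then show ?case
      using p0 by (simp add: Suc_le_eq div_greater_zero_iff)
  next
    case (3 n)
    moreover have "\<not> p dvd n div p ^ multiplicity p n"
      using 3 p by (intro multiplicity_decompose) auto
    ultimately show ?case by blast
  qed auto
  show "(\<lambda>n. (multiplicity p n - 1, n div p ^ multiplicity p n)) ((\<lambda>(m, k). p ^ Suc m * k) x) = x"
    if "x \<in> UNIV \<times> {k\<in>{1..}. \<not> p dvd k}" for x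
  proof -
    obtain m k where x: "x = (m, k)" by force
    with that have "\<not> p dvd k" by auto
    then have "multiplicity p (p ^ Suc m * k) = Suc m"
      using p by (intro multiplicity_eqI) (auto simp: p0)
    then show ?thesis
      using p0 x by (simp del: power_Suc)
  qed
  show "(\<lambda>(m, k). p ^ Suc m * k) ((\<lambda>n. (multiplicity p n - 1, n div p ^ multiplicity p n)) n) = n"
    if "n \<in> {n\<in>{1..}. p dvd n}" for n
  proof -
    \<comment> \<open>Positivity makes \<open>Suc\<close> undo the truncated subtraction
      \<open>multiplicity p n - 1\<close>.\<close>
    have "multiplicity p n > 0"
      using that p by (simp add: prime_multiplicity_gt_zero_iff)
    then show ?thesis
      by (simp add: multiplicity_dvd del: power_Suc)
  qed
qed

lemma infsum_multiples_of_prime: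
  fixes g :: "nat \<Rightarrow> complex"
  assumes g: "multiplicative_fun g" and summ: "g summable_on {1..}" and p: "prime p"
    and ne: "(\<Sum>m. g (p ^ Suc m)) \<noteq> -1"
  shows "infsum g {n\<in>{1..}. p dvd n} =
           infsum g {1..} * ((\<Sum>m. g (p ^ Suc m)) / (1 + (\<Sum>m. g (p ^ Suc m))))"
proof -
  define a where "a = (\<Sum>m. g (p ^ Suc m))"
  define D where "D = {n\<in>{1..}. p dvd n}"
  define K where "K = {k\<in>{1..}. \<not> p dvd k}"
  have sD: "g summable_on D" and sK: "g summable_on K"
    by (rule summable_on_subset_banach[OF summ]; auto simp: D_def K_def)+
  have bij: "bij_betw (\<lambda>(m, k). p ^ Suc m * k) (UNIV \<times> K) D"
    unfolding D_def K_def by (rule bij_betw_prime_part[OF p])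
  have p0: "p > 0" and p1: "p > 1"
    by (rule prime_gt_0_nat[OF p], rule prime_gt_1_nat[OF p])
  have g_split: "g (p ^ Suc m * k) = g (p ^ Suc m) * g k" if "k \<in> K" for m k
    using that p p0
    by (intro multiplicative_funD[OF g])
       (auto simp: K_def prime_imp_coprime Suc_le_eq simp del: power_Suc)
  have inj: "inj (\<lambda>m. p ^ Suc m)"
    using p1 by (auto intro!: injI simp del: power_Suc)
  have "g summable_on range (\<lambda>m. p ^ Suc m)"
    by (rule summable_on_subset_banach[OF summ]) (use p0 in \<open>auto simp: Suc_le_eq\<close>)
  then have spow: "(\<lambda>m. g (p ^ Suc m)) summable_on UNIV"
    by (simp only: summable_on_reindex[OF inj] o_def)
  \<comment> \<open>The ordered series in the statement must agree with the unordered sum, which is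
    the form that can be rearranged; summability over the powers of p, inherited from
    \<open>{1..}\<close>, ensures this.\<close>
  then have a: "infsum (\<lambda>m. g (p ^ Suc m)) UNIV = a"
    unfolding a_def by (metis has_sum_imp_sums has_sum_infsum sums_unique)
  \<comment> \<open>Fubini needs summability over the whole product; the bijection transports it
    from \<open>D\<close>.\<close>
  have "(\<lambda>(m, k). g (p ^ Suc m * k)) summable_on UNIV \<times> K"
    using sD summable_on_reindex_bij_betw[OF bij, of g] by (simp add: case_prod_unfold)
  then have "infsum (\<lambda>m. infsum (\<lambda>k. g (p ^ Suc m * k)) K) UNIV =
        infsum (\<lambda>(m, k). g (p ^ Suc m * k)) (UNIV \<times> K)"
    by (rule infsum_Sigma'_banach)
  also have "\<dots> = infsum g D"
    using infsum_reindex_bij_betw[OF bij, of g] by (simp add: case_prod_unfold)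
  also have "infsum (\<lambda>m. infsum (\<lambda>k. g (p ^ Suc m * k)) K) UNIV =
        infsum (\<lambda>m. g (p ^ Suc m) * infsum g K) UNIV"
    by (intro infsum_cong) (simp add: g_split infsum_cmult_right' del: power_Suc cong: infsum_cong)
  also have "\<dots> = a * infsum g K"
    by (simp add: infsum_cmult_left' a del: power_Suc)
  finally have D: "infsum g D = a * infsum g K" ..
  have "infsum g {1..} = infsum g (D \<union> K)"
    by (rule arg_cong[where f = "infsum g"]) (auto simp: D_def K_def)
  also have "\<dots> = infsum g D + infsum g K"
    by (rule infsum_Un_disjoint[OF sD sK]) (auto simp: D_def K_def)
  finally have "infsum g {1..} = (1 + a) * infsum g K"
    by (simp add: D algebra_simps)
  \<comment> \<open>This allows solving for the sum over \<open>K\<close>, which is then replaced in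
    \<open>D\<close> by G / (1 + a), with G the full sum.\<close>
  moreover have "1 + a \<noteq> 0"
    using ne by (simp add: a_def add_eq_0_iff)
  ultimately show ?thesis
    using D by (simp add: a_def D_def)
qed

text \<open>Double counting of the pairs (n, p) with p a prime divisor of n: the fibre over n has
  \<open>omega n\<close> elements, and the fibre over p consists of the positive multiples of
  p.\<close>

lemma infsum_omega_mult:
  fixes g :: "nat \<Rightarrow> complex"
  assumes "(\<lambda>n. of_nat (omega n) * g n) summable_on {1..}"
  shows "(\<Sum>\<^sub>\<infinity>n\<in>{1..}. of_nat (omega n) * g n) =
           (\<Sum>\<^sub>\<infinity>p | prime p. infsum g {n\<in>{1..}. p dvd n})"
proof -
  let ?S = "Sigma {1..} (prime_factors :: nat \<Rightarrow> nat set)"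
    and ?T = "Sigma {p::nat. prime p} (\<lambda>p. {n\<in>{1..}. p dvd n})"
  have bij: "bij_betw prod.swap ?T ?S"
    by (rule bij_betwI[where g = prod.swap]) (auto simp: in_prime_factors_iff Suc_le_eq intro: Nat.gr0I)
  have "(\<lambda>n. norm (of_nat (omega n) * g n)) summable_on {1..}"
    using assms by (simp only: summable_on_iff_abs_summable_on_complex)
  \<comment> \<open>On the finite fibre over n the norms add up to \<open>omega n\<close> times the
    norm of \<open>g n\<close>, so the assumption is exactly absolute summability over the
    pairs.\<close>
  then have "(\<lambda>x. norm (case x of (n, p) \<Rightarrow> g n)) summable_on ?S"
    by (subst Infinite_Sum.abs_summable_on_Sigma_iff) (auto simp: omega_def norm_mult)
  then have sS: "(\<lambda>(n, p). g n) summable_on ?S"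
    by (rule abs_summable_summable)
  have sT: "(\<lambda>(p, n). g n) summable_on ?T"
    using sS summable_on_reindex_bij_betw[OF bij, of "\<lambda>(n, p). g n"]
    by (simp add: case_prod_unfold)
  have "(\<Sum>\<^sub>\<infinity>n\<in>{1..}. of_nat (omega n) * g n) = infsum (\<lambda>(n, p). g n) ?S"
    using infsum_Sigma'_banach[OF sS] by (simp add: omega_def)
  also have "\<dots> = infsum (\<lambda>(p, n). g n) ?T"
    using infsum_reindex_bij_betw[OF bij, of "\<lambda>(n, p). g n"] by (simp add: case_prod_unfold)
  also have "\<dots> = (\<Sum>\<^sub>\<infinity>p\<in>{p. prime p}. infsum g {n\<in>{1..}. p dvd n})"
    using infsum_Sigma'_banach[OF sT] by simp
  finally show ?thesis .
qed

text \<open>In the prime factorization of n, each of the \<open>omega n\<close> prime powers is at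
  least 2.\<close>

lemma two_power_omega_le:
  assumes "n > 0"
  shows "2 ^ omega n \<le> n"
proof -
  have "2 ^ omega n = (\<Prod>p\<in>prime_factors n. 2 :: nat)"
    by (simp add: omega_def)
  also have "\<dots> \<le> (\<Prod>p\<in>prime_factors n. p ^ multiplicity p n)"
  proof (rule prod_mono, intro conjI)
    fix p assume "p \<in> prime_factors n"
    then have "p \<ge> 2" and "multiplicity p n > 0"
      by (auto simp: prime_factors_multiplicity prime_ge_2_nat)
    then show "2 \<le> p ^ multiplicity p n"
      by (meson order_trans self_le_power one_le_numeral)
  qed simp
  also have "\<dots> = n"
    using prod_prime_factors[of n] assms by simp
  finally show ?thesis .
qed

text \<open>Taking logarithms in 2^omega(n) \<le> n gives omega(n) ln 2 \<le> ln n, and ln n \<le>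
  n^\<epsilon> / \<epsilon>.\<close>

lemma omega_le_powr:
  assumes "n > 0" "\<epsilon> > 0"
  shows "real (omega n) \<le> real n powr \<epsilon> / (\<epsilon> * ln 2)"
proof -
  have "real (omega n) * ln 2 = ln (2 ^ omega n)"
    by (simp add: ln_realpow)
  also have "\<dots> \<le> ln (real n)"
    using of_nat_mono[OF two_power_omega_le[OF assms(1)], where 'a = real] assms(1)
    by (subst ln_le_cancel_iff) auto
  also have "\<dots> \<le> real n powr \<epsilon> / \<epsilon>"
    using assms by (intro ln_powr_bound) auto
  finally show ?thesis
    using assms(2) by (simp add: field_simps)
qed

text \<open>The rule (xy)^s = x^s y^s can fail for complex bases because of the branch cut, but
  holds for nonnegative reals. The case p = 0 is excluded since \<open>0 powr 0 = 0\<close>, which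
  breaks the identity at m = 0.\<close>

lemma powr_of_nat_power:
  "(of_nat (p ^ m) :: complex) powr s = of_nat p powr (of_nat m * s)" if "p > 0"
  using that
proof (induction m)
  case (Suc m)
  then show ?case
    by (simp add: powr_times_real powr_add distrib_right)
qed simp

lemma multiplicative_fun_dirichlet_term:
  assumes "multiplicative_fun f"
  shows "multiplicative_fun (\<lambda>n. f n / of_nat n powr s)"
  using assms unfolding multiplicative_fun_def by (auto simp: powr_times_real)

theorem theorem4p3:
  fixes f :: "nat \<Rightarrow> complex" and \<sigma>\<^sub>a :: real
  assumes "multiplicative_fun f"
    and "\<And>s p. Re s > \<sigma>\<^sub>a \<Longrightarrow> prime p \<Longrightarrow> local_sum f s p \<noteq> -1"
    and "\<And>s. Re s > \<sigma>\<^sub>a \<Longrightarrow> (\<lambda>n. norm (f n / of_nat n powr s)) summable_on {1..}"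
    and "\<And>s. Re s > \<sigma>\<^sub>a \<Longrightarrow>
           (\<lambda>p. norm (local_sum f s p / (1 + local_sum f s p))) summable_on {p. prime p}"
  shows "\<forall>s. Re s > \<sigma>\<^sub>a \<longrightarrow>
           (\<lambda>n. norm (of_nat (omega n) * f n / of_nat n powr s)) summable_on {1..} \<and>
           (\<Sum>\<^sub>\<infinity>n\<in>{1..}. of_nat (omega n) * f n / of_nat n powr s) =
             (\<Sum>\<^sub>\<infinity>n\<in>{1..}. f n / of_nat n powr s) *
             (\<Sum>\<^sub>\<infinity>p | prime p. local_sum f s p / (1 + local_sum f s p))"
proof (intro allI impI conjI)
  fix s :: complex assume s: "Re s > \<sigma>\<^sub>a"
  define g where "g n = f n / of_nat n powr s" for n
  \<comment> \<open>Half the distance to the abscissa, so that s - \<epsilon> stays in the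
    half-plane of absolute convergence.\<close>
  define \<epsilon> where "\<epsilon> = (Re s - \<sigma>\<^sub>a) / 2"
  have \<epsilon>: "\<epsilon> > 0" and s': "Re (s - of_real \<epsilon>) > \<sigma>\<^sub>a"
    using s by (auto simp: \<epsilon>_def field_simps)
  \<comment> \<open>The majorant: the factor n^\<epsilon> from the bound on omega shifts s to s -
    \<epsilon>, and the constant 1 / (\<epsilon> ln 2) comes from
    \<open>omega_le_powr\<close>.\<close>
  have "(\<lambda>n. norm (f n / of_nat n powr (s - of_real \<epsilon>) * of_real (1 / (\<epsilon> * ln 2)))) summable_on {1..}"
    unfolding norm_mult by (intro summable_on_cmult_left assms(3) s')
  then show abs: "(\<lambda>n. norm (of_nat (omega n) * f n / of_nat n powr s)) summable_on {1..}"
  proof (rule Infinite_Sum.abs_summable_on_comparison_test)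
    fix n :: nat assume "n \<in> {1..}"
    then have n: "n > 0" by simp
    have "norm (of_nat (omega n) * f n / of_nat n powr s) =
        real (omega n) * (norm (f n) / real n powr Re s)"
      by (simp add: norm_mult norm_divide norm_powr_real_powr)
    also have "\<dots> \<le> real n powr \<epsilon> / (\<epsilon> * ln 2) * (norm (f n) / real n powr Re s)"
      by (intro mult_right_mono omega_le_powr n \<epsilon>) simp
    also have "\<dots> = norm (f n / of_nat n powr (s - of_real \<epsilon>) * of_real (1 / (\<epsilon> * ln 2)))"
      using \<epsilon> by (simp add: norm_mult norm_divide norm_powr_real_powr powr_diff mult_ac)
    finally show "norm (of_nat (omega n) * f n / of_nat n powr s) \<le> \<dots>" .
  qed
  have mult: "multiplicative_fun g"
    unfolding g_def by (rule multiplicative_fun_dirichlet_term[OF assms(1)])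
  have summ: "g summable_on {1..}"
    unfolding g_def by (rule abs_summable_summable[OF assms(3)[OF s]])
  have loc: "local_sum f s p = (\<Sum>m. g (p ^ Suc m))" if "prime p" for p
    unfolding local_sum_def g_def
    using powr_of_nat_power[of p "Suc _" s] that by (simp add: prime_gt_0_nat del: power_Suc)
  have "(\<Sum>\<^sub>\<infinity>n\<in>{1..}. of_nat (omega n) * f n / of_nat n powr s) =
      (\<Sum>\<^sub>\<infinity>n\<in>{1..}. of_nat (omega n) * g n)"
    by (simp add: g_def)
  also have "\<dots> = (\<Sum>\<^sub>\<infinity>p | prime p. infsum g {n\<in>{1..}. p dvd n})"
    using abs_summable_summable[OF abs] by (intro infsum_omega_mult) (simp add: g_def)
  also have "\<dots> = (\<Sum>\<^sub>\<infinity>p | prime p.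
      infsum g {1..} * (local_sum f s p / (1 + local_sum f s p)))"
    using infsum_multiples_of_prime[OF mult summ] assms(2)[OF s]
    by (intro infsum_cong) (simp add: loc del: power_Suc)
  also have "\<dots> = infsum g {1..} * (\<Sum>\<^sub>\<infinity>p | prime p. local_sum f s p / (1 + local_sum f s p))"
    by (rule infsum_cmult_right')
  finally show "(\<Sum>\<^sub>\<infinity>n\<in>{1..}. of_nat (omega n) * f n / of_nat n powr s) =
      (\<Sum>\<^sub>\<infinity>n\<in>{1..}. f n / of_nat n powr s) *
      (\<Sum>\<^sub>\<infinity>p | prime p. local_sum f s p / (1 + local_sum f s p))"
    by (simp only: g_def[abs_def])
qed

end
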